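(* If $T$ is a tree with $\operatorname{diam}(T)=3$, then $\operatorname{con}(T\overline{T})=n(T)+\Delta(T)-1$.
   Context: For a graph $G$ with complement $\overline{G}$, the complementary prism $G\overline{G}$ is the graph obtained from the disjoint union of $G$ and $\overline{G}$ by adding the perfect matching joining each vertex $v$ of $G$ to its copy $\overline{v}$ in $\overline{G}$. For a graph $H$, a set $S\subseteq V(H)$ is (geodesically) convex if every vertex on every shortest path between two vertices of $S$ belongs to $S$. The convexity number $\operatorname{con}(H)$ is the maximum cardinality of a proper (i.e. $\neq V(H)$) convex set of $H$. $n(T)=|V(T)|$ and $\Delta(T)$ is the maximum degree of $T$. *)

theory Defs
  imports "Graph_Theory.Graph_Theory"
begin

text \<open>
  Finite simple undirected graphs are the symmetric, loop-free, finite digraphs of the locale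
  \<^locale>\<open>pair_graph\<close>; each undirected edge is a pair of opposite arcs.
\<close>

text \<open>
  On a symmetric digraph, traversing an edge back and forth already counts as a
  \<^const>\<open>pre_digraph.cycle\<close> (of length 2), so \<^const>\<open>tree\<close> does not describe undirected trees.
  In a simple graph the undirected cycles are exactly the cycles of length at least 3.
\<close>

definition undirected_tree :: "'a pair_pre_digraph \<Rightarrow> bool" where
  "undirected_tree T \<longleftrightarrow> pair_graph T \<and> connected (with_proj T) \<and>
     \<not> (\<exists>p. pre_digraph.cycle (with_proj T) p \<and> 3 \<le> length p)"

definition max_degree :: "('a, 'b) pre_digraph \<Rightarrow> nat" where
  "max_degree G = Max (out_degree G ` verts G)"

text \<open>
  With all arcs of weight 1, the cost of a walk is its length; the distance between vertices in
  different components is \<open>\<infinity>\<close>.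
\<close>

definition graph_dist :: "('a, 'b) pre_digraph \<Rightarrow> 'a \<Rightarrow> 'a \<Rightarrow> ereal" where
  "graph_dist G u v = wf_digraph.\<mu> G (\<lambda>_. 1) u v"

definition graph_diam :: "('a, 'b) pre_digraph \<Rightarrow> ereal" where
  "graph_diam G = (SUP u\<in>verts G. SUP v\<in>verts G. graph_dist G u v)"

definition shortest_path :: "('a, 'b) pre_digraph \<Rightarrow> 'a \<Rightarrow> 'b awalk \<Rightarrow> 'a \<Rightarrow> bool" where
  "shortest_path G u p v \<longleftrightarrow>
     pre_digraph.apath G u p v \<and> ereal (real (length p)) = graph_dist G u v"

definition geodesically_convex :: "('a, 'b) pre_digraph \<Rightarrow> 'a set \<Rightarrow> bool" where
  "geodesically_convex G S \<longleftrightarrow> S \<subseteq> verts G \<and>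
     (\<forall>u\<in>S. \<forall>v\<in>S. \<forall>p. shortest_path G u p v \<longrightarrow> set (pre_digraph.awalk_verts G u p) \<subseteq> S)"

definition convexity_number :: "('a, 'b) pre_digraph \<Rightarrow> nat" where
  "convexity_number G = Max (card ` {S. geodesically_convex G S \<and> S \<noteq> verts G})"

definition graph_complement :: "'a pair_pre_digraph \<Rightarrow> 'a pair_pre_digraph" where
  "graph_complement G = \<lparr> pverts = pverts G,
     parcs = {(u, v). u \<in> pverts G \<and> v \<in> pverts G \<and> u \<noteq> v \<and> (u, v) \<notin> parcs G} \<rparr>"

text \<open>\<open>Inl v\<close> is the vertex \<open>v\<close> of \<open>G\<close> and \<open>Inr v\<close> its copy in the complement.\<close>

definition complementary_prism :: "'a pair_pre_digraph \<Rightarrow> ('a + 'a) pair_pre_digraph" where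
  "complementary_prism G = \<lparr> pverts = pverts G <+> pverts (graph_complement G),
     parcs = {(Inl u, Inl v) | u v. (u, v) \<in> parcs G}
       \<union> {(Inr u, Inr v) | u v. (u, v) \<in> parcs (graph_complement G)}
       \<union> {(Inl v, Inr v) | v. v \<in> pverts G}
       \<union> {(Inr v, Inl v) | v. v \<in> pverts G} \<rparr>"

lemma pair_graph_intro:
  assumes "finite (pverts G)" "parcs G \<subseteq> pverts G \<times> pverts G"
    "sym (parcs G)" "irrefl (parcs G)"
  shows "pair_graph G"
proof -
  have "finite (parcs G)"
    using assms by (meson finite_SigmaI finite_subset)
  then show ?thesis
    using assms
    by unfold_locales (auto simp: symmetric_def irrefl_def)
qed

lemma pair_graph_graph_complement:
  assumes "pair_graph G"
  shows "pair_graph (graph_complement G)"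
proof -
  interpret pair_graph G by fact
  show ?thesis
    by (rule pair_graph_intro)
      (auto simp: graph_complement_def pair_finite_verts irrefl_def intro!: symI dest: arcs_symmetric)
qed

lemma pair_graph_complementary_prism:
  assumes "pair_graph G"
  shows "pair_graph (complementary_prism G)"
proof -
  interpret G: pair_graph G by fact
  interpret C: pair_graph "graph_complement G"
    using assms by (rule pair_graph_graph_complement)
  show ?thesis
  proof (rule pair_graph_intro)
    show "finite (pverts (complementary_prism G))"
      by (simp add: complementary_prism_def G.pair_finite_verts C.pair_finite_verts)
    show "parcs (complementary_prism G)
        \<subseteq> pverts (complementary_prism G) \<times> pverts (complementary_prism G)"
      by (auto simp: complementary_prism_def graph_complement_def dest: G.in_arcsD1 G.in_arcsD2)
    show "sym (parcs (complementary_prism G))"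
      by (auto simp: complementary_prism_def intro!: symI dest: G.arcs_symmetric C.arcs_symmetric)
    show "irrefl (parcs (complementary_prism G))"
      by (auto simp: complementary_prism_def irrefl_def dest: G.pair_no_loops C.pair_no_loops)
  qed
qed

end

theory Submission
  imports Defs
begin

text \<open>
  A tree of diameter 3 is a double star: two adjacent centres \<open>a\<close>, \<open>b\<close> with nonempty sets of leaves
  \<open>A\<close>, \<open>B\<close>. In the prism, a convex set containing both \<open>Inr a\<close> and \<open>Inr b\<close> contains their
  geodesics of length 3 and hence everything; so does a convex set containing \<open>Inl x\<close> and \<open>Inl y\<close>
  with \<open>x \<in> A\<close>, \<open>y \<in> B\<close>. A proper convex set therefore misses, say, all of \<open>Inl ` B\<close> and one of
  the \<open>Inr\<close>-centres, and also \<open>Inl b\<close> or all of \<open>Inr ` B\<close>, because \<open>Inl y\<close> lies between \<open>Inl b\<close>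
  and \<open>Inr y\<close>. This bounds its size, and the bound is attained by
  \<open>Inl ` insert a A \<union> Inr ` insert a (A \<union> B)\<close> for the larger side \<open>A\<close>.
\<close>

section \<open>Distances and shortest paths as powers of the arc relation\<close>

lemma (in wf_digraph) relpow_arcs_ends_iff_awalk:
  assumes "u \<in> verts G"
  shows "(u, v) \<in> arcs_ends G ^^ k \<longleftrightarrow> (\<exists>p. awalk u p v \<and> length p = k)"
  using assms
proof (induction k arbitrary: u)
  case 0
  then show ?case by (auto simp: awalk_Nil_iff)
next
  case (Suc k)
  have "(u, v) \<in> arcs_ends G ^^ Suc k \<longleftrightarrow>
      (\<exists>e\<in>arcs G. tail G e = u \<and> (head G e, v) \<in> arcs_ends G ^^ k)"
    unfolding relpow.simps(2) relpow_commute[symmetric] by (auto simp: arcs_ends_conv)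
  also have "\<dots> \<longleftrightarrow> (\<exists>e\<in>arcs G. tail G e = u \<and> (\<exists>p. awalk (head G e) p v \<and> length p = k))"
    using Suc.IH by auto
  also have "\<dots> \<longleftrightarrow> (\<exists>p. awalk u p v \<and> length p = Suc k)"
    unfolding length_Suc_conv by (auto simp: awalk_Cons_iff) (metis awalk_Cons_iff, blast)
  finally show ?case .
qed

text \<open>Replaces an infimum in \<open>ereal\<close> by relation powers, which simplification
  unfolds for the small exponents that occur later.\<close>

lemma (in wf_digraph) graph_dist_le_iff:
  assumes "u \<in> verts G"
  shows "graph_dist G u v \<le> ereal (real k) \<longleftrightarrow> (\<exists>j\<le>k. (u, v) \<in> arcs_ends G ^^ j)"
proof -
  have cost: "awalk_cost (\<lambda>_. 1) p = real (length p)" for p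
    by (induction p) auto
  have dist: "graph_dist G u v = (INF p\<in>{p. awalk u p v}. ereal (real (length p)))"
    by (simp add: graph_dist_def \<mu>_def cost)
  show ?thesis
  proof
    assume "graph_dist G u v \<le> ereal (real k)"
    \<comment> \<open>Only a strict bound on an infimum yields a witness; since lengths are
      integers, \<open>< Suc k\<close> loses nothing.\<close>
    then have "graph_dist G u v < ereal (real (Suc k))"
      by (rule order.strict_trans1) simp
    then obtain p where "awalk u p v" "length p < Suc k"
      unfolding dist INF_less_iff by auto
    then show "\<exists>j\<le>k. (u, v) \<in> arcs_ends G ^^ j"
      using relpow_arcs_ends_iff_awalk[OF assms] by (metis less_Suc_eq_le)
  next
    assume "\<exists>j\<le>k. (u, v) \<in> arcs_ends G ^^ j"
    then obtain p where "awalk u p v" "length p \<le> k"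
      using relpow_arcs_ends_iff_awalk[OF assms] by metis
    then show "graph_dist G u v \<le> ereal (real k)"
      unfolding dist by (intro INF_lower2[of p]) auto
  qed
qed

lemma (in wf_digraph) shortest_path_iff:
  "shortest_path G u p v \<longleftrightarrow> apath u p v \<and> (\<forall>j<length p. (u, v) \<notin> arcs_ends G ^^ j)"
proof (cases "apath u p v")
  case True
  then have walk: "awalk u p v" and u: "u \<in> verts G"
    by (auto simp: apath_def awalk_def)
  have le: "graph_dist G u v \<le> ereal (real (length p))"
    using walk graph_dist_le_iff[OF u] relpow_arcs_ends_iff_awalk[OF u] by blast
  show ?thesis
  proof
    assume "shortest_path G u p v"
    then have "ereal (real (length p)) = graph_dist G u v"
      by (simp add: shortest_path_def)
    then show "apath u p v \<and> (\<forall>j<length p. (u, v) \<notin> arcs_ends G ^^ j)"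
      using True graph_dist_le_iff[OF u, of v] by (metis ereal_less_eq(3) linorder_not_le of_nat_le_iff order_refl)
  next
    assume *: "apath u p v \<and> (\<forall>j<length p. (u, v) \<notin> arcs_ends G ^^ j)"
    have "ereal (real (length p)) \<le> graph_dist G u v"
      unfolding graph_dist_def \<mu>_def
    proof (rule INF_greatest)
      fix q assume "q \<in> {q. awalk u q v}"
      then have "(u, v) \<in> arcs_ends G ^^ length q"
        using relpow_arcs_ends_iff_awalk[OF u] by blast
      then have "length p \<le> length q"
        using * linorder_not_le by blast
      moreover have "awalk_cost (\<lambda>_. 1) q = real (length q)"
        by (induction q) auto
      ultimately show "ereal (real (length p)) \<le> ereal (awalk_cost (\<lambda>_. 1) q)"
        by simp
    qed
    then show "shortest_path G u p v"
      using True le by (simp add: shortest_path_def)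
  qed
qed (simp add: shortest_path_def)

section \<open>Convexity and cycles in simple graphs\<close>

context pair_wf_digraph
begin

text \<open>Distinct nonadjacent vertices with a common neighbour have distance 2, so the path
  through \<open>w\<close> is a geodesic.\<close>

lemma convex_common_neighbour:
  assumes "geodesically_convex (with_proj G) S" "u \<in> S" "v \<in> S"
    and "(u, w) \<in> parcs G" "(w, v) \<in> parcs G" "u \<noteq> v" "(u, v) \<notin> parcs G"
  shows "w \<in> S"
proof -
  have "shortest_path (with_proj G) u [(u, w), (w, v)] v"
    using assms by (auto simp: shortest_path_iff apath_simps less_Suc_eq numeral_2_eq_2 intro: in_arcsD2)
  then show ?thesis
    using assms unfolding geodesically_convex_def by fastforce
qed

lemma convex_geodesic3:
  assumes "geodesically_convex (with_proj G) S" "u \<in> S" "v \<in> S"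
    and "(u, w) \<in> parcs G" "(w, z) \<in> parcs G" "(z, v) \<in> parcs G"
    and "u \<noteq> v" "(u, v) \<notin> parcs G" "(u, v) \<notin> parcs G O parcs G"
  shows "w \<in> S" "z \<in> S"
proof -
  have "shortest_path (with_proj G) u [(u, w), (w, z), (z, v)] v"
    using assms
    by (auto simp: shortest_path_iff apath_simps less_Suc_eq numeral_2_eq_2 intro: in_arcsD2)
  then have "set (pre_digraph.awalk_verts (with_proj G) u [(u, w), (w, z), (z, v)]) \<subseteq> S"
    using assms unfolding geodesically_convex_def by blast
  then show "w \<in> S" "z \<in> S" by auto
qed

text \<open>By \<open>diam\<close>, a geodesic between vertices of \<open>S\<close> has at most one
  inner vertex. Convexity then only concerns common neighbours, and one outside \<open>S\<close>
  does no harm when its two neighbours in \<open>S\<close> coincide or are adjacent.\<close>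

lemma geodesically_convexI:
  assumes "S \<subseteq> pverts G"
    and diam: "\<And>u v. u \<in> S \<Longrightarrow> v \<in> S \<Longrightarrow>
      u = v \<or> (u, v) \<in> parcs G \<or> (u, v) \<in> parcs G O parcs G"
    and nbrs: "\<And>u v w. u \<in> S \<Longrightarrow> v \<in> S \<Longrightarrow> (u, w) \<in> parcs G \<Longrightarrow> (w, v) \<in> parcs G \<Longrightarrow>
      w \<notin> S \<Longrightarrow> u = v \<or> (u, v) \<in> parcs G"
  shows "geodesically_convex (with_proj G) S"
  unfolding geodesically_convex_def
proof (intro conjI ballI allI impI)
  fix u v p assume uv: "u \<in> S" "v \<in> S" and "shortest_path (with_proj G) u p v"
  then have path: "apath u p v" and short: "\<And>j. j < length p \<Longrightarrow> (u, v) \<notin> parcs G ^^ j"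
    by (auto simp: shortest_path_iff)
  have "length p \<le> 2"
  proof (rule ccontr)
    assume "\<not> length p \<le> 2"
    then have "0 < length p" "1 < length p" "2 < length p"
      by linarith+
    then show False
      using diam[OF uv] short[of 0] short[of 1] short[of 2] by (auto simp: numeral_2_eq_2)
  qed
  then consider "p = []" | e where "p = [e]" | e f where "p = [e, f]"
    by (cases p; cases "tl p"; cases "tl (tl p)") auto
  then show "set (pre_digraph.awalk_verts (with_proj G) u p) \<subseteq> S"
  proof cases
    case 3
    obtain w where ef: "e = (u, w)" "f = (w, v)" "(u, w) \<in> parcs G" "(w, v) \<in> parcs G"
      using path 3 by (cases e; cases f) (auto simp: apath_simps)
    have "u \<noteq> v" "(u, v) \<notin> parcs G"
      using short[of 0] short[of 1] 3 by auto
    then have "w \<in> S"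
      using nbrs[OF uv ef(3,4)] by blast
    then show ?thesis using uv 3 ef by auto
  qed (use path uv in \<open>auto simp: apath_simps\<close>)
qed (use assms in simp)

text \<open>Walks are lists of arcs, whereas the tree arguments name vertices; zipping a vertex list
  with its tail translates between the two.\<close>

lemma awalk_zip_tl:
  assumes "u \<in> pverts G" "successively (\<lambda>x y. (x, y) \<in> parcs G) (u # xs)"
  shows "awalk u (zip (u # xs) xs) (last (u # xs)) \<and>
    pre_digraph.awalk_verts (with_proj G) u (zip (u # xs) xs) = u # xs"
  using assms
proof (induction xs arbitrary: u)
  case (Cons x xs)
  then show ?case
    using in_arcsD2[of u x] by (auto simp: awalk_Cons_iff)
qed (simp add: awalk_Nil_iff)

lemma cycle_of_distinct_verts:
  assumes "successively (\<lambda>x y. (x, y) \<in> parcs G) (x # xs)" "(last (x # xs), x) \<in> parcs G"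
    and "distinct (x # xs)"
  shows "cycle (zip (x # xs @ [x]) (xs @ [x]))"
proof -
  have "successively (\<lambda>x y. (x, y) \<in> parcs G) (x # xs @ [x])"
    using assms(1,2) by (simp flip: append_Cons add: successively_append_iff)
  then have "awalk x (zip (x # xs @ [x]) (xs @ [x])) x"
    "pre_digraph.awalk_verts (with_proj G) x (zip (x # xs @ [x]) (xs @ [x])) = x # xs @ [x]"
    using awalk_zip_tl[of x "xs @ [x]"] assms(2) by (auto dest: in_arcsD2)
  then show ?thesis
    using assms(3) unfolding cycle_def by (intro exI[of _ x]) auto
qed

end

section \<open>Trees of diameter 3 are double stars\<close>

text \<open>The working form of acyclicity. At least three distinct vertices are required because an
  edge traversed back and forth is a cycle of length 2.\<close>

lemma undirected_tree_no_cycle: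
  assumes "undirected_tree T" "distinct (x # xs)" "2 \<le> length xs"
    and "successively (\<lambda>x y. (x, y) \<in> parcs T) (x # xs)"
  shows "(last (x # xs), x) \<notin> parcs T"
proof
  assume last: "(last (x # xs), x) \<in> parcs T"
  interpret pair_graph T
    using assms(1) by (simp add: undirected_tree_def)
  have "cycle (zip (x # xs @ [x]) (xs @ [x]))"
    using assms last by (intro cycle_of_distinct_verts)
  moreover have "3 \<le> length (zip (x # xs @ [x]) (xs @ [x]))"
    using assms(3) by simp
  ultimately show False
    using assms(1) unfolding undirected_tree_def by blast
qed

text \<open>A walk of length at most 3 between the ends of a path with four edges would, together
  with the path, create a cycle.\<close>

lemma undirected_tree_path4_geodesic:
  assumes "undirected_tree T" "distinct [w, z, a, b, y]"
    and "(w, z) \<in> parcs T" "(z, a) \<in> parcs T" "(a, b) \<in> parcs T" "(b, y) \<in> parcs T"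
    and "j \<le> 3"
  shows "(w, y) \<notin> parcs T ^^ j"
proof -
  interpret pair_graph T
    using assms(1) by (simp add: undirected_tree_def)
  note nc = undirected_tree_no_cycle[OF assms(1)]
  note sym = arcs_symmetric
  have 1: "(w, y) \<notin> parcs T"
    using nc[of w "[z, a, b, y]"] assms by (auto dest: sym)
  have chords: "(w, a) \<notin> parcs T" "(w, b) \<notin> parcs T"
    "(z, b) \<notin> parcs T" "(z, y) \<notin> parcs T" "(a, y) \<notin> parcs T"
    using nc[of w "[z, a]"] nc[of w "[z, a, b]"] nc[of z "[a, b]"] nc[of z "[a, b, y]"]
      nc[of a "[b, y]"] assms by (auto dest: sym)
  have 2: False if "(w, c) \<in> parcs T" "(c, y) \<in> parcs T" for c
  proof -
    have "c \<notin> {w, z, a, b, y}"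
      using that chords assms(2) by (auto dest: no_loops')
    then show False
      using nc[of w "[z, a, b, y, c]"] assms that by (auto dest: sym)
  qed
  \<comment> \<open>The detour \<open>w, c, d, y\<close> can meet the path inside only at
    \<open>c = z\<close> or \<open>d = b\<close>. If both hold, it contains the excluded chord from
    \<open>z\<close> to \<open>b\<close>; otherwise the parts that differ close a cycle.\<close>
  have 3: False if "(w, c) \<in> parcs T" "(c, d) \<in> parcs T" "(d, y) \<in> parcs T" for c d
  proof -
    have c: "c \<notin> {w, a, b, y}" and d: "d \<notin> {w, z, a, y}" and cd: "c \<noteq> d"
      using that chords 1 by (auto dest: no_loops')
    consider "c = z" "d = b" | "c = z" "d \<noteq> b" | "c \<noteq> z" "d = b" | "c \<noteq> z" "d \<noteq> b"
      by blast
    then show False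
    proof cases
      case 1
      then show ?thesis using that chords by simp
    next
      case 2
      then show ?thesis
        using nc[of z "[a, b, y, d]"] assms that d by (auto dest: sym)
    next
      case 3
      then show ?thesis
        using nc[of w "[z, a, b, c]"] assms that c by (auto dest: sym)
    next
      case 4
      then show ?thesis
        using nc[of w "[z, a, b, y, d, c]"] assms that c d cd by (auto dest: sym)
    qed
  qed
  consider "j = 0" | "j = 1" | "j = 2" | "j = 3"
    using assms(7) by linarith
  then show ?thesis
    using assms(2) 1 2 3 by cases (auto simp: numeral_2_eq_2 numeral_3_eq_3)
qed

text \<open>Nonempty sides exclude stars. The explicit arc set lets simplification decide adjacency
  in \<open>T\<close> and in the prism.\<close>

definition double_star :: "'a pair_pre_digraph \<Rightarrow> 'a \<Rightarrow> 'a \<Rightarrow> 'a set \<Rightarrow> 'a set \<Rightarrow> bool" where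
  "double_star T a b A B \<longleftrightarrow> finite A \<and> finite B \<and> A \<noteq> {} \<and> B \<noteq> {} \<and> A \<inter> B = {} \<and>
     a \<noteq> b \<and> a \<notin> A \<union> B \<and> b \<notin> A \<union> B \<and> pverts T = {a, b} \<union> A \<union> B \<and>
     parcs T = {(a, b), (b, a)} \<union> {a} \<times> A \<union> A \<times> {a} \<union> {b} \<times> B \<union> B \<times> {b}"

lemma double_star_commute: "double_star T a b A B \<longleftrightarrow> double_star T b a B A"
  unfolding double_star_def by (auto simp: Un_ac insert_commute)

text \<open>The inner vertices of a diametral path \<open>x, a, b, y\<close> are the centres. A
  vertex beyond their neighbours would start a geodesic of length 4, and an arc between leaves would
  close a cycle.\<close>

lemma undirected_tree_diam_3_double_star:
  assumes "undirected_tree T" "graph_diam (with_proj T) = 3"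
  obtains a b A B where "double_star T a b A B"
proof -
  interpret pair_graph T
    using assms(1) by (simp add: undirected_tree_def)
  note nc = undirected_tree_no_cycle[OF assms(1)]
  note sym = arcs_symmetric
  have diam: "\<exists>j\<le>3. (u, v) \<in> parcs T ^^ j" if "u \<in> pverts T" "v \<in> pverts T" for u v
  proof -
    have "graph_dist (with_proj T) u v \<le> graph_diam (with_proj T)"
      unfolding graph_diam_def using that by (intro SUP_upper2[of u] SUP_upper) auto
    then show ?thesis
      using graph_dist_le_iff[of u v 3] that assms(2) by simp
  qed
  \<comment> \<open>If all distances were at most 2, so would be their supremum, the
    diameter.\<close>
  have "\<exists>x\<in>pverts T. \<exists>y\<in>pverts T. \<forall>j\<le>2. (x, y) \<notin> parcs T ^^ j"
  proof (rule ccontr)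
    assume "\<not> ?thesis"
    then have "graph_dist (with_proj T) u v \<le> 2" if "u \<in> pverts T" "v \<in> pverts T" for u v
      using graph_dist_le_iff[of u v 2] that by auto
    then have "graph_diam (with_proj T) \<le> 2"
      unfolding graph_diam_def by (auto intro!: SUP_least)
    then show False using assms(2) by simp
  qed
  then obtain x y where xy: "x \<in> pverts T" "y \<in> pverts T" "\<And>j. j \<le> 2 \<Longrightarrow> (x, y) \<notin> parcs T ^^ j"
    by blast
  then have far: "x \<noteq> y" "(x, y) \<notin> parcs T" "(x, y) \<notin> parcs T O parcs T"
    using xy(3)[of 0] xy(3)[of 1] xy(3)[of 2] by (auto simp: numeral_2_eq_2)
  obtain j where "j \<le> 3" "(x, y) \<in> parcs T ^^ j"
    using diam xy by blast
  moreover from this have "j = 3"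
    using xy(3)[of j] by linarith
  ultimately obtain a b where path: "(x, a) \<in> parcs T" "(a, b) \<in> parcs T" "(b, y) \<in> parcs T"
    by (auto simp: numeral_3_eq_3)
  have dist: "distinct [x, a, b, y]"
    using path far by (auto dest: no_loops')
  define A where "A = {z. (a, z) \<in> parcs T \<and> z \<noteq> b}"
  define B where "B = {z. (b, z) \<in> parcs T \<and> z \<noteq> a}"
  have ne: "x \<in> A" "y \<in> B"
    using path dist by (auto simp: A_def B_def dest: sym)
  have sub: "A \<subseteq> pverts T" "B \<subseteq> pverts T"
    by (auto simp: A_def B_def dest: in_arcsD2)
  have disj: "A \<inter> B = {}"
    using nc[of a "[b, z]" for z] path dist by (auto simp: A_def B_def dest: sym no_loops')
  \<comment> \<open>A new neighbour \<open>z\<close> of some \<open>w\<close> in \<open>A\<close>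
    gives the path \<open>z, w, a, b, y\<close> with four edges, too long for the diameter; for
    \<open>w\<close> in \<open>B\<close> the path is \<open>z, w, b, a, x\<close>.\<close>
  have closed: "z \<in> {a, b} \<union> A \<union> B" if "w \<in> {a, b} \<union> A \<union> B" "(w, z) \<in> parcs T" for w z
  proof (rule ccontr)
    assume z: "\<not> ?thesis"
    then have "w \<in> A \<or> w \<in> B"
      using that by (auto simp: A_def B_def)
    then show False
    proof
      assume w: "w \<in> A"
      have "(z, y) \<notin> parcs T ^^ j" if "j \<le> 3" for j
        using w z \<open>(w, z) \<in> parcs T\<close> path ne dist disj that
        by (intro undirected_tree_path4_geodesic[OF assms(1), of z w a b y])
          (auto simp: A_def dest: sym no_loops')
      then show False
        using diam[of z y] that(2) xy(2) by (auto dest: in_arcsD2)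
    next
      assume w: "w \<in> B"
      have "(z, x) \<notin> parcs T ^^ j" if "j \<le> 3" for j
        using w z \<open>(w, z) \<in> parcs T\<close> path ne dist disj that
        by (intro undirected_tree_path4_geodesic[OF assms(1), of z w b a x])
          (auto simp: B_def dest: sym no_loops')
      then show False
        using diam[of z x] that(2) xy(1) by (auto dest: in_arcsD2)
    qed
  qed
  have reach: "w \<in> {a, b} \<union> A \<union> B" if "(u, w) \<in> parcs T ^^ j" "u \<in> {a, b} \<union> A \<union> B" for u w j
    using that
  proof (induction j arbitrary: w)
    case (Suc j)
    then show ?case using closed by auto
  qed simp
  have verts: "pverts T = {a, b} \<union> A \<union> B"
  proof
    show "pverts T \<subseteq> {a, b} \<union> A \<union> B"
      using diam[OF xy(1)] reach[of x] ne by blast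
  qed (use sub path in \<open>auto dest: in_arcsD1 in_arcsD2\<close>)
  \<comment> \<open>Such an arc closes a triangle with one centre if both ends are on the same side,
    and a 4-cycle with both centres otherwise.\<close>
  have leaves: "(w, z) \<notin> parcs T" if "w \<in> A \<union> B" "z \<in> A \<union> B" for w z
  proof
    assume wz: "(w, z) \<in> parcs T"
    consider "w \<in> A" "z \<in> A" | "w \<in> B" "z \<in> B" | "w \<in> A" "z \<in> B" | "w \<in> B" "z \<in> A"
      using \<open>w \<in> A \<union> B\<close> \<open>z \<in> A \<union> B\<close> by blast
    then show False
    proof cases
      case 1
      then show ?thesis using nc[of a "[w, z]"] wz by (auto simp: A_def dest: sym no_loops')
    next
      case 2
      then show ?thesis using nc[of b "[w, z]"] wz by (auto simp: B_def dest: sym no_loops')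
    next
      case 3
      then show ?thesis
        using nc[of a "[w, z, b]"] wz path disj by (auto simp: A_def B_def dest: sym no_loops')
    next
      case 4
      then show ?thesis
        using nc[of a "[z, w, b]"] wz path disj by (auto simp: A_def B_def dest: sym no_loops')
    qed
  qed
  have "parcs T = {(a, b), (b, a)} \<union> {a} \<times> A \<union> A \<times> {a} \<union> {b} \<times> B \<union> B \<times> {b}" (is "_ = ?R")
  proof
    show "parcs T \<subseteq> ?R"
    proof
      fix e assume "e \<in> parcs T"
      moreover obtain u v where "e = (u, v)" by fastforce
      ultimately have uv: "(u, v) \<in> parcs T" and e: "e = (u, v)" by auto
      then have "u \<in> {a, b} \<union> A \<union> B" "v \<in> {a, b} \<union> A \<union> B"
        using verts by (auto dest: in_arcsD1 in_arcsD2)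
      moreover have "u \<noteq> v" "(v, u) \<in> parcs T" "\<not> (u \<in> A \<union> B \<and> v \<in> A \<union> B)"
        using uv leaves by (auto dest: no_loops' sym)
      ultimately show "e \<in> ?R"
        using uv e unfolding A_def B_def by blast
    qed
    show "?R \<subseteq> parcs T"
      using path by (auto simp: A_def B_def intro: sym)
  qed
  moreover have "finite A" "finite B"
    using sub by (auto intro: finite_subset[OF _ pair_finite_verts])
  moreover have "a \<notin> A \<union> B" "b \<notin> A \<union> B"
    using dist by (auto simp: A_def B_def dest: no_loops')
  ultimately have "double_star T a b A B"
    unfolding double_star_def using ne disj verts dist by auto
  then show thesis by (rule that)
qed

text \<open>The successor counts the edge between the centres; it cancels the subtraction of 1 in
  the final formula.\<close>

lemma max_degree_double_star:
  assumes "double_star T a b A B"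
  shows "max_degree (with_proj T) = Suc (max (card A) (card B))"
proof -
  have fin: "finite A" "finite B" and ne: "A \<noteq> {}" "B \<noteq> {}" and notin: "b \<notin> A" "a \<notin> B"
    using assms by (auto simp: double_star_def)
  have "out_arcs (with_proj T) a = Pair a ` insert b A"
    "out_arcs (with_proj T) b = Pair b ` insert a B"
    using assms by (auto simp: double_star_def out_arcs_def)
  then have ab: "out_degree (with_proj T) a = Suc (card A)" "out_degree (with_proj T) b = Suc (card B)"
    using fin notin by (simp_all add: out_degree_def card_image inj_on_def del: image_insert)
  have "out_arcs (with_proj T) x = {(x, a)}" if "x \<in> A" for x
    using assms that by (auto simp: double_star_def out_arcs_def)
  moreover have "out_arcs (with_proj T) y = {(y, b)}" if "y \<in> B" for y
    using assms that by (auto simp: double_star_def out_arcs_def)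
  ultimately have leaf: "out_degree (with_proj T) v = 1" if "v \<in> A \<union> B" for v
    using that by (auto simp: out_degree_def)
  have "out_degree (with_proj T) ` (A \<union> B) = {1}"
    using leaf ne by force
  then have "out_degree (with_proj T) ` verts (with_proj T) = {Suc (card A), Suc (card B), 1}"
    using assms ab by (auto simp: double_star_def image_Un)
  then show ?thesis
    by (simp add: max_degree_def max_def)
qed

section \<open>A large convex set in the prism\<close>

lemma complementary_prism_verts [simp]:
  "pverts (complementary_prism T) = pverts T <+> pverts T"
  by (simp add: complementary_prism_def graph_complement_def)

lemma complementary_prism_arcs [simp]:
  "(Inl u, Inl v) \<in> parcs (complementary_prism T) \<longleftrightarrow> (u, v) \<in> parcs T"
  "(Inl u, Inr v) \<in> parcs (complementary_prism T) \<longleftrightarrow> u = v \<and> u \<in> pverts T"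
  "(Inr u, Inl v) \<in> parcs (complementary_prism T) \<longleftrightarrow> u = v \<and> u \<in> pverts T"
  "(Inr u, Inr v) \<in> parcs (complementary_prism T) \<longleftrightarrow>
     u \<in> pverts T \<and> v \<in> pverts T \<and> u \<noteq> v \<and> (u, v) \<notin> parcs T"
  by (auto simp: complementary_prism_def graph_complement_def)

text \<open>Every vertex outside this set has at most one neighbour in it, except \<open>Inr b\<close>, whose
  neighbours in it form the clique \<open>Inr ` A\<close>; since its diameter is 2, convexity follows.\<close>

lemma double_star_prism_convex_set:
  assumes "pair_graph T" "double_star T a b A B"
  shows "geodesically_convex (with_proj (complementary_prism T))
    (Inl ` insert a A \<union> Inr ` insert a (A \<union> B))" (is "geodesically_convex _ ?S")
proof -
  let ?E = "parcs (complementary_prism T)"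
  interpret P: pair_graph "complementary_prism T"
    using assms(1) by (rule pair_graph_complementary_prism)
  obtain y0 where y0: "y0 \<in> B"
    using assms(2) by (auto simp: double_star_def)
  have spoke: "(Inl a, Inl x) \<in> ?E" if "x \<in> A" for x
    using assms(2) that by (auto simp: double_star_def)
  have cospoke: "(Inr a, Inr y) \<in> ?E" if "y \<in> B" for y
    using assms(2) that by (auto simp: double_star_def)
  have rung: "(Inl z, Inr z) \<in> ?E" if "z \<in> {a, b} \<union> A \<union> B" for z
    using assms(2) that by (simp add: double_star_def)
  have clique: "z = z' \<or> (Inr z, Inr z') \<in> ?E" if "z \<in> A \<union> B" "z' \<in> A \<union> B" for z z'
    using assms(2) that by (auto simp: double_star_def)
  note sym = P.arcs_symmetric
  \<comment> \<open>Distance at most 2, in the form required by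
    \<open>geodesically_convexI\<close>.\<close>
  define near where "near u v \<longleftrightarrow> u = v \<or> (u, v) \<in> ?E \<or> (u, v) \<in> ?E O ?E" for u v
  have near_sym: "near v u" if "near u v" for u v
    using that sym unfolding near_def by blast
  have near_LL: "near (Inl p) (Inl q)" if "p \<in> insert a A" "q \<in> insert a A" for p q
    using that spoke sym unfolding near_def by blast
  have near_LR: "near (Inl p) (Inr q)" if pq: "p \<in> insert a A" "q \<in> insert a (A \<union> B)" for p q
  proof -
    consider "p = q" | "p = a" "q \<in> A" | "p = a" "q \<in> B" | "p \<in> A" "q = a" | "p \<in> A" "q \<in> A \<union> B"
      using pq by blast
    then show ?thesis
    proof cases
      case 1
      then show ?thesis using rung pq unfolding near_def by blast
    next
      case 2
      then show ?thesis using spoke rung unfolding near_def by blast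
    next
      case 3
      then show ?thesis using cospoke rung[of a] unfolding near_def by blast
    next
      case 4
      then show ?thesis using spoke sym rung[of a] unfolding near_def by blast
    next
      case 5
      then show ?thesis using clique[of p q] rung[of p] unfolding near_def by blast
    qed
  qed
  \<comment> \<open>In the complement \<open>a\<close> is adjacent to no vertex of \<open>A\<close>,
    so \<open>Inr y0\<close> serves as midpoint; this uses that \<open>B\<close> is
    nonempty.\<close>
  have near_aR: "near (Inr a) (Inr q)" if "q \<in> insert a (A \<union> B)" for q
    using that cospoke clique[of y0 q] y0 unfolding near_def by blast
  have near_RR: "near (Inr p) (Inr q)" if "p \<in> insert a (A \<union> B)" "q \<in> insert a (A \<union> B)" for p q
    using that near_aR near_sym clique[of p q] unfolding near_def by blast
  show ?thesis
  proof (rule P.geodesically_convexI)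
    show "?S \<subseteq> pverts (complementary_prism T)"
      using assms by (auto simp: double_star_def)
  next
    fix u v assume "u \<in> ?S" "v \<in> ?S"
    then have "near u v"
      by (elim UnE imageE) (simp_all only: near_LL near_LR near_RR near_sym[OF near_LR])
    then show "u = v \<or> (u, v) \<in> ?E \<or> (u, v) \<in> ?E O ?E"
      by (simp add: near_def)
  next
    fix u v w assume uv: "u \<in> ?S" "v \<in> ?S" and w: "(u, w) \<in> ?E" "(w, v) \<in> ?E" "w \<notin> ?S"
    have "w \<in> pverts (complementary_prism T)"
      using w(1) by (rule P.in_arcsD2)
    then consider "w = Inl b" | "w = Inr b" | y where "w = Inl y" "y \<in> B"
      using w(3) assms(2) by (auto simp: double_star_def)
    then show "u = v \<or> (u, v) \<in> ?E"
    proof cases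
      case 1
      have "z = Inl a" if "z \<in> ?S" "(w, z) \<in> ?E" for z
        using that 1 assms(2) by (auto simp: double_star_def)
      then show ?thesis using uv w sym by metis
    next
      case 2
      have "z \<in> Inr ` A" if "z \<in> ?S" "(w, z) \<in> ?E" for z
        using that 2 assms(2) by (auto simp: double_star_def)
      then have "u \<in> Inr ` A" "v \<in> Inr ` A" using uv w sym by blast+
      then show ?thesis using clique by blast
    next
      case 3
      have "z = Inr y" if "z \<in> ?S" "(w, z) \<in> ?E" for z
        using that 3 assms(2) by (auto simp: double_star_def)
      then show ?thesis using uv w sym by metis
    qed
  qed
qed

section \<open>Upper bound for proper convex sets\<close>

text \<open>Geodesics from \<open>Inr a\<close> to \<open>Inr b\<close> run through
  \<open>Inl a, Inl b\<close> and through \<open>Inr y, Inr x\<close> for all leaves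
  \<open>x\<close> in \<open>A\<close>, \<open>y\<close> in \<open>B\<close>. The remaining
  \<open>Inl x\<close> and \<open>Inl y\<close> lie between \<open>Inl a\<close> and
  \<open>Inr x\<close>, and between \<open>Inl b\<close> and \<open>Inr y\<close>.\<close>

lemma double_star_prism_convex_centres:
  assumes "pair_graph T" "double_star T a b A B"
    and conv: "geodesically_convex (with_proj (complementary_prism T)) S"
    and "Inr a \<in> S" "Inr b \<in> S"
  shows "S = pverts (complementary_prism T)"
proof -
  interpret P: pair_graph "complementary_prism T"
    using assms(1) by (rule pair_graph_complementary_prism)
  \<comment> \<open>The neighbours of \<open>Inr a\<close> are \<open>Inl a\<close> and
    \<open>Inr\<close> B\<open>, those of\<close>Inr b\<open>are\<close>Inl b\<open>and\<close>Inr
    \<open>A\<close>: no common one.\<close>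
  have far: "(Inr a, Inr b) \<notin> parcs (complementary_prism T) O parcs (complementary_prism T)"
  proof
    assume "(Inr a, Inr b) \<in> parcs (complementary_prism T) O parcs (complementary_prism T)"
    then obtain w where "(Inr a, w) \<in> parcs (complementary_prism T)"
      "(w, Inr b) \<in> parcs (complementary_prism T)" by auto
    then show False
      using assms(2) by (cases w) (auto simp: double_star_def)
  qed
  note geodesic = P.convex_geodesic3[OF conv assms(4,5) _ _ _ _ _ far]
  have centres: "Inl a \<in> S" "Inl b \<in> S"
    using geodesic[of "Inl a" "Inl b"] assms(2) by (auto simp: double_star_def)
  have bars: "Inr y \<in> S" "Inr x \<in> S" if "x \<in> A" "y \<in> B" for x y
    using geodesic[of "Inr y" "Inr x"] assms(2) that by (auto simp: double_star_def)
  obtain x0 y0 where "x0 \<in> A" "y0 \<in> B"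
    using assms(2) by (auto simp: double_star_def)
  with bars have bars: "Inr v \<in> S" if "v \<in> A \<union> B" for v
    using that by blast
  have "Inl x \<in> S" if "x \<in> A" for x
    using P.convex_common_neighbour[OF conv, of "Inl a" "Inr x" "Inl x"] centres bars that assms(2)
    by (auto simp: double_star_def)
  moreover have "Inl y \<in> S" if "y \<in> B" for y
    using P.convex_common_neighbour[OF conv, of "Inl b" "Inr y" "Inl y"] centres bars that assms(2)
    by (auto simp: double_star_def)
  ultimately have "pverts (complementary_prism T) \<subseteq> S"
    using centres bars assms(2,4,5) by (auto simp: double_star_def)
  then show ?thesis
    using conv by (auto simp: geodesically_convex_def)
qed

text \<open>The geodesics through \<open>Inl a, Inl b\<close> and through
  \<open>Inr x, Inr y\<close> lie in \<open>S\<close>. Then \<open>Inr a\<close>, between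
  \<open>Inl a\<close> and \<open>Inr y\<close>, and \<open>Inr b\<close>, between
  \<open>Inl b\<close> and \<open>Inr x\<close>, reduce this to the case of the two centres.\<close>

lemma double_star_prism_convex_leaves:
  assumes "pair_graph T" "double_star T a b A B"
    and conv: "geodesically_convex (with_proj (complementary_prism T)) S"
    and "x \<in> A" "y \<in> B" "Inl x \<in> S" "Inl y \<in> S"
  shows "S = pverts (complementary_prism T)"
proof -
  interpret P: pair_graph "complementary_prism T"
    using assms(1) by (rule pair_graph_complementary_prism)
  have far: "(Inl x, Inl y) \<notin> parcs (complementary_prism T) O parcs (complementary_prism T)"
  proof
    assume "(Inl x, Inl y) \<in> parcs (complementary_prism T) O parcs (complementary_prism T)"
    then obtain w where "(Inl x, w) \<in> parcs (complementary_prism T)"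
      "(w, Inl y) \<in> parcs (complementary_prism T)" by auto
    then show False
      using assms(2,4,5) by (cases w) (auto simp: double_star_def)
  qed
  note geodesic = P.convex_geodesic3[OF conv assms(6,7) _ _ _ _ _ far]
  have "Inl a \<in> S" "Inl b \<in> S" "Inr x \<in> S" "Inr y \<in> S"
    using geodesic[of "Inl a" "Inl b"] geodesic[of "Inr x" "Inr y"] assms(2,4,5)
    by (auto simp: double_star_def)
  then have "Inr a \<in> S" "Inr b \<in> S"
    using P.convex_common_neighbour[OF conv, of "Inl a" "Inr y" "Inr a"]
      P.convex_common_neighbour[OF conv, of "Inl b" "Inr x" "Inr b"] assms(2,4,5)
    by (auto simp: double_star_def)
  then show ?thesis
    using double_star_prism_convex_centres[OF assms(1,2) conv] by blast
qed

lemma double_star_prism_convex_missing_side: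
  assumes "pair_graph T" "double_star T a b A B"
    and conv: "geodesically_convex (with_proj (complementary_prism T)) S"
    and proper: "S \<noteq> pverts (complementary_prism T)"
    and B: "Inl ` B \<inter> S = {}"
  shows "card B + 2 \<le> card (pverts (complementary_prism T) - S)"
proof -
  interpret P: pair_graph "complementary_prism T"
    using assms(1) by (rule pair_graph_complementary_prism)
  let ?R = "pverts (complementary_prism T) - S"
  have "card (Inl ` B :: ('a + 'a) set) = card B"
    by (simp add: card_image)
  moreover have fin: "finite B" using assms(2) by (simp add: double_star_def)
  moreover obtain c where c: "c \<in> {a, b}" "Inr c \<notin> S"
    using double_star_prism_convex_centres[OF assms(1-3)] proper by blast
  moreover obtain y where y: "y \<in> B" using assms(2) by (auto simp: double_star_def)
  have "\<not> (Inl b \<in> S \<and> Inr y \<in> S)"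
    using P.convex_common_neighbour[OF conv, of "Inl b" "Inr y" "Inl y"] B y assms(2)
    by (auto simp: double_star_def)
  then obtain d where d: "d \<in> {Inl b, Inr y}" "d \<notin> S" by blast
  have "insert d (insert (Inr c) (Inl ` B)) \<subseteq> ?R"
    using B c d y assms(2) by (auto simp: double_star_def)
  then have "card (insert d (insert (Inr c) (Inl ` B))) \<le> card ?R"
    by (intro card_mono) (use P.pair_finite_verts in blast)+
  moreover have "d \<noteq> Inr c" "d \<notin> Inl ` B" "Inr c \<notin> Inl ` B"
    using c(1) d(1) y assms(2) by (auto simp: double_star_def)
  ultimately show ?thesis by simp
qed

lemma double_star_prism_convex_card_le:
  assumes "pair_graph T" "double_star T a b A B"
    and conv: "geodesically_convex (with_proj (complementary_prism T)) S"
    and proper: "S \<noteq> pverts (complementary_prism T)"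
  shows "card S \<le> card (pverts T) + max (card A) (card B)"
proof -
  interpret P: pair_graph "complementary_prism T"
    using assms(1) by (rule pair_graph_complementary_prism)
  have "Inl ` A \<inter> S = {} \<or> Inl ` B \<inter> S = {}"
    using double_star_prism_convex_leaves[OF assms(1-3)] proper by blast
  \<comment> \<open>Either side may be the missing one, so only the smaller loss is certain. Out of
    \<open>2 * (card A + card B + 2)\<close> vertices this leaves at most
    \<open>card (pverts T)\<close> plus the larger side.\<close>
  then have "min (card A) (card B) + 2 \<le> card (pverts (complementary_prism T) - S)"
    using double_star_prism_convex_missing_side[OF assms]
      double_star_prism_convex_missing_side[OF assms(1) _ conv proper] assms(2)
      double_star_commute[of T a b A B] by fastforce
  moreover have "S \<subseteq> pverts (complementary_prism T)"
    using conv by (simp add: geodesically_convex_def)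
  then have "card (pverts (complementary_prism T) - S) + card S = card (pverts (complementary_prism T))"
    using P.pair_finite_verts by (metis card_Diff_subset card_mono finite_subset le_add_diff_inverse2)
  moreover have "card (pverts T) = card A + card B + 2"
    using assms(2) by (auto simp: double_star_def card_Un_disjoint)
  moreover from this have "card (pverts (complementary_prism T)) = 2 * (card A + card B + 2)"
    by (simp add: card_Plus card_ge_0_finite)
  ultimately show ?thesis by (simp add: min_def max_def split: if_splits)
qed

lemma double_star_prism_convex_card_ge:
  assumes "pair_graph T" "double_star T a b A B"
  shows "\<exists>S. geodesically_convex (with_proj (complementary_prism T)) S \<and>
    S \<noteq> pverts (complementary_prism T) \<and> card S = card (pverts T) + card A"
proof (intro exI conjI)
  let ?S = "Inl ` insert a A \<union> Inr ` insert a (A \<union> B)"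
  show "geodesically_convex (with_proj (complementary_prism T)) ?S"
    using assms by (rule double_star_prism_convex_set)
  have "Inl b \<in> pverts (complementary_prism T) - ?S"
    using assms(2) by (auto simp: double_star_def)
  then show "?S \<noteq> pverts (complementary_prism T)" by blast
  \<comment> \<open>As a disjoint sum the set has
    \<open>(card A + 1) + (card A + card B + 1)\<close> elements, which is
    \<open>card (pverts T) + card A\<close>.\<close>
  have "?S = insert a A <+> insert a (A \<union> B)"
    by (simp add: Plus_def)
  then have "card ?S = card (insert a A) + card (insert a (A \<union> B))"
    using assms(2) by (simp only: card_Plus finite_insert finite_Un double_star_def)
  then show "card ?S = card (pverts T) + card A"
    using assms(2) by (simp add: double_star_def card_Un_disjoint)
qed

section \<open>The convexity number\<close>

theorem theorem3p11:
  fixes T :: "'a pair_pre_digraph"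
  assumes "undirected_tree T"
    and "graph_diam (with_proj T) = 3"
  shows "convexity_number (with_proj (complementary_prism T))
    = card (pverts T) + max_degree (with_proj T) - 1"
proof -
  have T: "pair_graph T"
    using assms(1) by (simp add: undirected_tree_def)
  interpret P: pair_graph "complementary_prism T"
    using T by (rule pair_graph_complementary_prism)
  obtain a b A B where ds: "double_star T a b A B"
    using assms by (rule undirected_tree_diam_3_double_star)
  let ?C = "{S. geodesically_convex (with_proj (complementary_prism T)) S \<and>
    S \<noteq> verts (with_proj (complementary_prism T))}"
  have "?C \<subseteq> Pow (pverts (complementary_prism T))"
    by (auto simp: geodesically_convex_def)
  then have "finite ?C"
    using P.pair_finite_verts by (meson finite_Pow_iff finite_subset)
  \<comment> \<open>The construction is applied to both orientations of the double star, so that the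
    larger side can play the role of \<open>A\<close>.\<close>
  moreover have "card (pverts T) + max (card A) (card B) \<in> card ` ?C"
    using double_star_prism_convex_card_ge[OF T ds]
      double_star_prism_convex_card_ge[OF T ds[unfolded double_star_commute[of T a]]]
    by (auto simp: max_def image_iff)
  ultimately have "convexity_number (with_proj (complementary_prism T)) =
      card (pverts T) + max (card A) (card B)"
    unfolding convexity_number_def using double_star_prism_convex_card_le[OF T ds]
    by (intro Max_eqI) auto
  then show ?thesis
    by (simp add: max_degree_double_star[OF ds])
qed

end
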